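(* For all integers $n\geq 1$, $|\mathrm{Av}^\star_{3n}(231)| = 3^{n-1}$.
   Context: For a positive integer $m$, $[m]=\{1,\dots,m\}$ and $\mathcal{S}_m$ is the set of permutations of $[m]$, written in one-line notation $\pi=\pi_1\pi_2\cdots\pi_m$ with $\pi_i=\pi(i)$. A permutation $\pi\in\mathcal{S}_m$ avoids a pattern $\sigma\in\mathcal{S}_k$ if there are no indices $i_1<\dots<i_k$ such that $\pi_{i_1}\cdots\pi_{i_k}$ is in the same relative order as $\sigma$. $\mathcal{S}^\star_{3n}$ denotes the set of permutations of $[3n]$ whose cycle decomposition consists only of 3-cycles, and $\mathrm{Av}^\star_{3n}(\sigma)$ is the set of permutations in $\mathcal{S}^\star_{3n}$ that avoid $\sigma$. *)

theory Defs
  imports "HOL-Combinatorics.Permutations" "HOL-Combinatorics.Orbits"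
begin

text \<open>
  A permutation of \<open>{1..m}\<close> is a function \<open>p :: nat \<Rightarrow> nat\<close> with \<open>p permutes {1..m}\<close>, i.e. a bijection
  that is the identity outside \<open>{1..m}\<close>, so that permutations of \<open>{1..m}\<close> and such functions correspond
  one to one. A pattern is given by its one-line notation as a list, e.g. \<open>[2, 3, 1]\<close>.
\<close>

definition contains_pattern :: "nat \<Rightarrow> (nat \<Rightarrow> nat) \<Rightarrow> nat list \<Rightarrow> bool" where
  \<comment> \<open>List positions count from 0: \<open>i a\<close> is the position in \<open>p\<close> of the letter matching \<open>\<sigma> ! a\<close>.\<close>
  "contains_pattern m p \<sigma> \<longleftrightarrow>
     (\<exists>i :: nat \<Rightarrow> nat. strict_mono_on {..<length \<sigma>} i \<and> i ` {..<length \<sigma>} \<subseteq> {1..m} \<and>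
        (\<forall>a<length \<sigma>. \<forall>b<length \<sigma>. p (i a) < p (i b) \<longleftrightarrow> \<sigma> ! a < \<sigma> ! b))"

definition cycles_of :: "'a set \<Rightarrow> ('a \<Rightarrow> 'a) \<Rightarrow> 'a set set" where
  \<comment> \<open>The supports of the cycles of a permutation of \<open>A\<close>, fixed points in \<open>A\<close> counting as 1-cycles.\<close>
  "cycles_of A p = orbit p ` A"

definition three_cycle_perms :: "nat \<Rightarrow> (nat \<Rightarrow> nat) set" where
  "three_cycle_perms n = {p. p permutes {1..3 * n} \<and> (\<forall>c \<in> cycles_of {1..3 * n} p. card c = 3)}"

definition Av_star :: "nat \<Rightarrow> nat list \<Rightarrow> (nat \<Rightarrow> nat) set" where
  "Av_star n \<sigma> = {p \<in> three_cycle_perms n. \<not> contains_pattern (3 * n) p \<sigma>}"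

end

theory Submission
  imports Defs
begin

text \<open>
  In a 231-avoiding permutation every 3-cycle on \<open>x < y < z\<close> has the form
  \<open>x \<mapsto> z \<mapsto> y \<mapsto> x\<close>. Everything to the left of the maximum is smaller than everything to its
  right, so the permutation splits into a shorter one and a block that starts with its maximum.
  On such a block of length \<open>3k\<close>, the first \<open>k\<close> positions carry the \<open>k\<close> largest values in decreasing
  order, the middle positions carry the \<open>k\<close> smallest values, and the rest is then determined.
  The block avoids 231 iff the middle word has no peak, that is, decreases and then increases, which
  leaves \<open>2^(k-1)\<close> words. Hence the numbers \<open>a n\<close> sought satisfy \<open>a 0 = 1\<close> and
  \<open>a n = (\<Sum>j<n. a j * 2^(n-1-j))\<close>, so \<open>a (n+1) = 3 * a n\<close> for \<open>n \<ge> 1\<close>.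
\<close>

section \<open>Fixed-point-free permutations of order three on ordered sets\<close>

text \<open>An equational form of having only 3-cycles: \<open>p o p\<close> inverts
  \<open>p\<close>, so bijectivity follows. The set \<open>I\<close> is arbitrary, so that blocks of
  a permutation can be treated on their own.\<close>

definition three_cyclic :: "'a set \<Rightarrow> ('a \<Rightarrow> 'a) \<Rightarrow> bool" where
  "three_cyclic I p \<longleftrightarrow>
     (\<forall>x\<in>I. p x \<noteq> x) \<and> (\<forall>x. x \<notin> I \<longrightarrow> p x = x) \<and> (\<forall>x. p (p (p x)) = x)"

definition avoids_231 :: "'a::linorder set \<Rightarrow> ('a \<Rightarrow> 'a) \<Rightarrow> bool" where
  "avoids_231 I p \<longleftrightarrow>
     (\<forall>i\<in>I. \<forall>j\<in>I. \<forall>k\<in>I. i < j \<longrightarrow> j < k \<longrightarrow> \<not> (p k < p i \<and> p i < p j))"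

definition three_cyclic_avoiders :: "'a::linorder set \<Rightarrow> ('a \<Rightarrow> 'a) set" where
  "three_cyclic_avoiders I = {p. three_cyclic I p \<and> avoids_231 I p}"

lemma three_cyclicD:
  assumes "three_cyclic I p"
  shows "x \<in> I \<Longrightarrow> p x \<noteq> x" "x \<notin> I \<Longrightarrow> p x = x" "p (p (p x)) = x"
  using assms by (auto simp: three_cyclic_def)

lemma three_cyclic_eq_iff: "three_cyclic I p \<Longrightarrow> p x = p y \<longleftrightarrow> x = y"
  by (metis three_cyclicD(3))

lemma three_cyclic_in_iff: "three_cyclic I p \<Longrightarrow> p x \<in> I \<longleftrightarrow> x \<in> I"
  by (metis three_cyclicD)

lemma three_cyclic_permutes: "three_cyclic I p \<Longrightarrow> p permutes I"
  unfolding permutes_def by (metis three_cyclicD(2,3))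

lemma avoids_231D:
  "\<lbrakk>avoids_231 I p; i \<in> I; j \<in> I; k \<in> I; i < j; j < k; p k < p i; p i < p j\<rbrakk> \<Longrightarrow> False"
  by (auto simp: avoids_231_def)

lemma avoidersD:
  assumes "p \<in> three_cyclic_avoiders I"
  shows "three_cyclic I p" "avoids_231 I p"
  using assms by (auto simp: three_cyclic_avoiders_def)

lemma finite_three_cyclic_avoiders: "finite I \<Longrightarrow> finite (three_cyclic_avoiders I)"
  by (rule finite_subset[OF _ finite_permutations[of I]])
     (auto simp: three_cyclic_avoiders_def intro: three_cyclic_permutes)

subsection \<open>Translation of the definitions\<close>

text \<open>The size of the orbit is the first return time. Conversely, a coincidence among
  \<open>x\<close>, \<open>p x\<close> and \<open>p (p x)\<close> would force
  \<open>p x = x\<close>.\<close>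

lemma card_orbit_3_iff:
  assumes "permutation p"
  shows "card (orbit p x) = 3 \<longleftrightarrow> p x \<noteq> x \<and> p (p (p x)) = x"
proof
  assume c: "card (orbit p x) = 3"
  have x: "x \<in> orbit p x"
    using assms by (rule permutation_self_in_orbit)
  have eq: "orbit p x = (\<lambda>n. (p ^^ n) x) ` {0..<funpow_dist1 p x x}"
    by (rule orbit_conv_funpow_dist1[OF x])
  have "inj_on (\<lambda>n. (p ^^ n) x) {0..<funpow_dist1 p x x}"
    by (rule inj_on_funpow_dist1[OF x])
  then have d: "funpow_dist1 p x x = 3"
    using c eq by (simp add: card_image)
  have "(p ^^ funpow_dist1 p x x) x = x"
    by (rule funpow_dist1_prop[OF x])
  then have "p (p (p x)) = x"
    unfolding d by (simp add: numeral_3_eq_3)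
  moreover have "p x \<noteq> x"
  proof
    assume "p x = x"
    then have "orbit p x = {x}"
      by (simp add: orbit_eq_singleton_iff)
    then show False using c by simp
  qed
  ultimately show "p x \<noteq> x \<and> p (p (p x)) = x" by simp
next
  assume h: "p x \<noteq> x \<and> p (p (p x)) = x"
  have "y \<in> {p x, p (p x), x}" if "y \<in> orbit p x" for y
    using that by induction (use h in auto)
  moreover have "{p x, p (p x), x} \<subseteq> orbit p x"
    using h by (metis empty_subsetI insert_subset orbit.base orbit.step)
  ultimately have "orbit p x = {p x, p (p x), x}" by blast
  moreover have "p (p x) \<noteq> x" "p (p x) \<noteq> p x" using h by metis+
  ultimately show "card (orbit p x) = 3" using h by simp
qed

lemma three_cycle_perms_iff: "p \<in> three_cycle_perms n \<longleftrightarrow> three_cyclic {1..3 * n} p"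
proof -
  have "(\<forall>c \<in> cycles_of {1..3 * n} p. card c = 3) \<longleftrightarrow>
        (\<forall>x\<in>{1..3 * n}. p x \<noteq> x \<and> p (p (p x)) = x)" if "p permutes {1..3 * n}"
    using card_orbit_3_iff[of p] that by (auto simp: cycles_of_def permutation_permutes)
  then show ?thesis
    unfolding three_cycle_perms_def three_cyclic_def
    using three_cyclic_permutes[of "{1..3 * n}" p] unfolding three_cyclic_def
    by (smt (verit) mem_Collect_eq permutes_not_in)
qed

lemma contains_231_iff: "contains_pattern m p [2, 3, 1] \<longleftrightarrow> \<not> avoids_231 {1..m} p"
proof
  have len: "length [2, 3, 1::nat] = 3" by simp
  assume "contains_pattern m p [2, 3, 1]"
  then obtain i :: "nat \<Rightarrow> nat" where
    mono: "strict_mono_on {..<3} i" and ran: "i ` {..<3} \<subseteq> {1..m}"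
    and pat: "\<forall>a<3. \<forall>b<3. p (i a) < p (i b) \<longleftrightarrow> [2, 3, 1::nat] ! a < [2, 3, 1] ! b"
    unfolding contains_pattern_def len by blast
  have "i 0 < i 1" "i 1 < i 2"
    using mono by (simp_all add: strict_mono_on_def)
  moreover have "i 0 \<in> {1..m}" "i 1 \<in> {1..m}" "i 2 \<in> {1..m}"
    using ran by (simp_all add: image_subset_iff)
  moreover have "p (i 2) < p (i 0)" "p (i 0) < p (i 1)"
    using pat[rule_format, of 2 0] pat[rule_format, of 0 1] by simp_all
  ultimately show "\<not> avoids_231 {1..m} p"
    by (meson avoids_231D)
next
  assume "\<not> avoids_231 {1..m} p"
  then obtain i j k where h: "i \<in> {1..m}" "j \<in> {1..m}" "k \<in> {1..m}" "i < j" "j < k"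
    "p k < p i" "p i < p j"
    by (auto simp: avoids_231_def)
  define f where "f a = [i, j, k] ! a" for a
  have *: "{..<length [2, 3, 1::nat]} = {0, 1, 2}" by auto
  have "strict_mono_on {..<length [2, 3, 1::nat]} f"
    unfolding strict_mono_on_def * using h by (auto simp: f_def)
  moreover have "f ` {..<length [2, 3, 1::nat]} \<subseteq> {1..m}"
    unfolding * using h by (auto simp: f_def)
  moreover have "\<forall>a<length [2, 3, 1::nat]. \<forall>b<length [2, 3, 1::nat].
      p (f a) < p (f b) \<longleftrightarrow> [2, 3, 1::nat] ! a < [2, 3, 1] ! b"
    using h by (auto simp: f_def less_Suc_eq numeral_3_eq_3)
  ultimately show "contains_pattern m p [2, 3, 1]"
    unfolding contains_pattern_def by blast
qed

text \<open>Half-open intervals are used from here on: the blocks \<open>{0<..c}\<close> and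
  \<open>{c<..d}\<close> fit together at \<open>c\<close> without index shifts.\<close>

lemma Av_star_231_eq: "Av_star n [2, 3, 1] = three_cyclic_avoiders {0<..3 * n}"
proof -
  have "{1..3 * n} = {0<..3 * n}" by auto
  then show ?thesis
    unfolding Av_star_def three_cyclic_avoiders_def
    by (simp only: three_cycle_perms_iff contains_231_iff not_not mem_Collect_eq)
qed

subsection \<open>The shape of the cycles\<close>

text \<open>If \<open>p (p x)\<close> were above \<open>p x\<close>, the values \<open>p x\<close>,
  \<open>p (p x)\<close>, \<open>x\<close> at positions \<open>x < p x < p (p x)\<close> would form
  231. If it were below \<open>x\<close>, so would the values \<open>x\<close>, \<open>p x\<close>,
  \<open>p (p x)\<close> at positions \<open>p (p x) < x < p x\<close>.\<close>

lemma cycle_shape: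
  assumes p: "p \<in> three_cyclic_avoiders I" and "x \<in> I" "x < p x"
  shows "x < p (p x)" "p (p x) < p x"
proof -
  note t = avoidersD(1)[OF p] and a = avoidersD(2)[OF p]
  note [simp] = three_cyclic_in_iff[OF t] three_cyclicD(3)[OF t] three_cyclic_eq_iff[OF t]
  have "p (p x) \<noteq> x"
    using three_cyclicD(1,3)[OF t] assms by metis
  moreover have "p (p x) \<noteq> p x" using assms(2,3) by auto
  moreover have "\<not> p x < p (p x)"
    using avoids_231D[OF a, of x "p x" "p (p x)"] assms by auto
  moreover have "\<not> p (p x) < x"
    using avoids_231D[OF a, of "p (p x)" x "p x"] assms by auto
  ultimately show "x < p (p x)" "p (p x) < p x" by (meson linorder_cases)+
qed

text \<open>The smallest elements of the cycles are exactly the excedances.\<close>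

lemma exists_excedance:
  assumes p: "p \<in> three_cyclic_avoiders I" and "x \<in> I"
  shows "x < p x \<or> p x < p (p x) \<or> p (p x) < x"
proof -
  have "p x \<noteq> x" using three_cyclicD(1)[OF avoidersD(1)[OF p]] assms by auto
  then show ?thesis by force
qed

text \<open>By \<open>cycle_shape\<close>, an excedance is followed on its cycle by the largest and
  then the middle element, neither of which is an excedance. The three sets thus collect the
  smallest, largest and middle elements of the cycles.\<close>

lemma excedance_partition:
  assumes p: "p \<in> three_cyclic_avoiders I"
  defines "M \<equiv> {x \<in> I. x < p x}"
  shows "I = M \<union> p ` M \<union> p ` p ` M"
    and "M \<inter> p ` M = {}" "M \<inter> p ` p ` M = {}" "p ` M \<inter> p ` p ` M = {}"
proof -
  note t = avoidersD(1)[OF p]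
  note [simp] = three_cyclic_in_iff[OF t] three_cyclicD(3)[OF t]
  show "I = M \<union> p ` M \<union> p ` p ` M"
  proof (intro equalityI subsetI)
    fix x assume x: "x \<in> I"
    consider "x \<in> M" | "p x \<in> M" | "p (p x) \<in> M"
      using exists_excedance[OF p x] x by (auto simp: M_def)
    then show "x \<in> M \<union> p ` M \<union> p ` p ` M"
    proof cases
      case 2
      then have "p (p (p x)) \<in> p ` p ` M" by blast
      then show ?thesis by simp
    next
      case 3
      then have "p (p (p x)) \<in> p ` M" by blast
      then show ?thesis by simp
    qed simp
  qed (auto simp: M_def)
  have *: "x < p (p x)" "p (p x) < p x" if "x \<in> M" for x
    using cycle_shape[OF p] that by (auto simp: M_def)
  show "M \<inter> p ` M = {}" "M \<inter> p ` p ` M = {}"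
    using * by (force simp: M_def)+
  show "p ` M \<inter> p ` p ` M = {}"
  proof (rule ccontr)
    assume "p ` M \<inter> p ` p ` M \<noteq> {}"
    then obtain x y where "x \<in> M" "y \<in> M" "p x = p (p y)" by auto
    then have "x = p y" using three_cyclic_eq_iff[OF t] by simp
    then show False using *[of y] \<open>x \<in> M\<close> \<open>y \<in> M\<close> by (auto simp: M_def)
  qed
qed

text \<open>Counts the cycles by their excedances. Besides the size of \<open>M\<close> in a block,
  it yields that an invariant prefix has length divisible by 3.\<close>

lemma card_excedances:
  assumes p: "p \<in> three_cyclic_avoiders I" and fin: "finite I"
  shows "card I = 3 * card {x \<in> I. x < p x}"
proof -
  define M where "M = {x \<in> I. x < p x}"
  note P = excedance_partition[OF p, folded M_def]
  have inj: "inj p"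
    using three_cyclic_eq_iff[OF avoidersD(1)[OF p]] by (auto intro: injI)
  have f: "finite M" using fin by (simp add: M_def)
  have "card (M \<union> p ` M \<union> p ` p ` M) = card (M \<union> p ` M) + card (p ` p ` M)"
    using P(3,4) f by (intro card_Un_disjoint) (simp_all add: Int_Un_distrib2)
  also have "card (M \<union> p ` M) = card M + card (p ` M)"
    using P(2) f by (intro card_Un_disjoint) simp_all
  finally have "card I = card M + card (p ` M) + card (p ` p ` M)"
    using P(1) by simp
  moreover have "card (p ` A) = card A" for A
    using inj by (metis card_image inj_on_subset subset_UNIV)
  ultimately show ?thesis by (simp add: M_def)
qed

subsection \<open>Initial and final segments of intervals\<close>

lemma initial_segment_eq:
  fixes A :: "nat set"
  assumes fin: "finite A" and gt: "\<And>a. a \<in> A \<Longrightarrow> s < a"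
    and down: "\<And>a b. \<lbrakk>a \<in> A; s < b; b < a\<rbrakk> \<Longrightarrow> b \<in> A"
  shows "A = {s<..s + card A}"
proof (cases "A = {}")
  case False
  have m: "Max A \<in> A" using Max_in[OF fin False] .
  have eq: "A = {s<..Max A}"
  proof (intro equalityI subsetI)
    fix x assume "x \<in> {s<..Max A}"
    then show "x \<in> A" using down[OF m, of x] m by (cases "x = Max A") auto
  qed (use fin gt in auto)
  have "card A = Max A - s" by (subst eq) simp
  then show ?thesis using eq gt[OF m] by simp
qed simp

text \<open>\<open>0 \<notin> A\<close> keeps the truncated difference \<open>t - card A\<close>
  exact: \<open>{0..t}\<close> has \<open>t + 1\<close> elements.\<close>

lemma final_segment_eq:
  fixes A :: "nat set"
  assumes pos: "0 \<notin> A" and le: "\<And>a. a \<in> A \<Longrightarrow> a \<le> t"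
    and up: "\<And>a b. \<lbrakk>a \<in> A; b \<le> t; a < b\<rbrakk> \<Longrightarrow> b \<in> A"
  shows "A = {t - card A<..t}"
proof (cases "A = {}")
  case False
  have fin: "finite A"
    by (rule finite_subset[of _ "{..t}"]) (auto intro: le)
  have m: "Min A \<in> A" using Min_in[OF fin False] .
  have eq: "A = {Min A..t}"
  proof (intro equalityI subsetI)
    fix x assume "x \<in> {Min A..t}"
    then show "x \<in> A" using up[OF m, of x] m by (cases "x = Min A") auto
  qed (use fin le in auto)
  have "0 < Min A" "Min A \<le> t" using pos m le by (auto intro: gr0I)
  moreover have "card A = Suc t - Min A" by (subst eq) simp
  ultimately have "{t - card A<..t} = {Min A..t}" by auto
  then show ?thesis using eq by simp
qed simp

text \<open>From the left end \<open>f\<close> drops by at least one per step, and going back from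
  the right end it rises by at least one per step. For intervals of equal length the two bounds
  coincide.\<close>

lemma decreasing_interval_map:
  fixes f :: "nat \<Rightarrow> nat"
  assumes ran: "\<And>x. x \<in> {s<..s + k} \<Longrightarrow> f x \<in> {u<..u + k}"
    and dec: "\<And>x y. \<lbrakk>x \<in> {s<..s + k}; y \<in> {s<..s + k}; x < y\<rbrakk> \<Longrightarrow> f y < f x"
    and x: "x \<in> {s<..s + k}"
  shows "f x = u + s + k + 1 - x"
proof -
  have up: "f (s + 1 + i) + i \<le> u + k" if "i < k" for i
    using that
  proof (induction i)
    case 0
    then show ?case using ran[of "s + 1"] by auto
  next
    case (Suc i)
    then show ?case using dec[of "s + 1 + i" "s + 1 + Suc i"] by auto
  qed
  have down: "u + 1 + i \<le> f (s + k - i)" if "i < k" for i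
    using that
  proof (induction i)
    case 0
    then show ?case using ran[of "s + k"] by auto
  next
    case (Suc i)
    then show ?case using dec[of "s + k - Suc i" "s + k - i"] by (simp; linarith)
  qed
  have "f x + (x - s - 1) \<le> u + k" "u + 1 + (s + k - x) \<le> f x"
    using up[of "x - s - 1"] down[of "s + k - x"] x by auto
  then show ?thesis using x by simp
qed

subsection \<open>Words without peaks\<close>

text \<open>For injective \<open>w\<close> this is avoidance of both 132 and 231.\<close>

definition peak_free :: "'a::linorder set \<Rightarrow> ('a \<Rightarrow> 'b::linorder) \<Rightarrow> bool" where
  "peak_free I w \<longleftrightarrow>
     (\<forall>i\<in>I. \<forall>j\<in>I. \<forall>k\<in>I. i < j \<longrightarrow> j < k \<longrightarrow> \<not> (w i < w j \<and> w k < w j))"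

definition valleys :: "'a::linorder set \<Rightarrow> 'b::{linorder, zero} set \<Rightarrow> ('a \<Rightarrow> 'b) set" where
  \<comment> \<open>The value 0 outside \<open>I\<close> makes functions on \<open>I\<close> unique.\<close>
  "valleys I J = {w. bij_betw w I J \<and> (\<forall>x. x \<notin> I \<longrightarrow> w x = 0) \<and> peak_free I w}"

text \<open>An end position is never the middle of a triple, and the maximum \<open>t\<close> placed
  there is smaller than no other value, so inserting it creates no peak. Deleting a letter never
  does.\<close>

lemma bij_betw_valleys_remove:
  assumes fin: "finite I" "finite J" and e: "e = Min I \<or> e = Max I" and eI: "e \<in> I"
    and t: "t = Max J" "t \<in> J"
  shows "bij_betw (\<lambda>w. w(e := 0)) {w \<in> valleys I J. w e = t} (valleys (I - {e}) (J - {t}))"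
proof (rule bij_betw_byWitness[where f' = "\<lambda>w. w(e := t)"])
  show "\<forall>w\<in>{w \<in> valleys I J. w e = t}. (w(e := 0))(e := t) = w"
    by auto
  show "\<forall>w\<in>valleys (I - {e}) (J - {t}). (w(e := t))(e := 0) = w"
    by (auto simp: valleys_def)
  show "(\<lambda>w. w(e := 0)) ` {w \<in> valleys I J. w e = t} \<subseteq> valleys (I - {e}) (J - {t})"
  proof clarify
    fix w assume w: "w \<in> valleys I J" and "t = w e"
    then have b: "bij_betw w (I - {e}) (J - {w e})"
      using eI by (intro bij_betw_DiffI) (auto simp: valleys_def bij_betw_def)
    have "bij_betw (w(e := 0)) (I - {e}) (J - {w e})"
      by (rule iffD1[OF bij_betw_cong b]) auto
    then show "w(e := 0) \<in> valleys (I - {e}) (J - {w e})"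
      using w by (auto simp: valleys_def peak_free_def)
  qed
  show "(\<lambda>w. w(e := t)) ` valleys (I - {e}) (J - {t}) \<subseteq> {w \<in> valleys I J. w e = t}"
  proof clarify
    fix w assume w: "w \<in> valleys (I - {e}) (J - {t})"
    then have b: "bij_betw w (I - {e}) (J - {t})" by (simp add: valleys_def)
    have "bij_betw (w(e := t)) (I - {e}) (J - {t})"
      by (rule iffD1[OF bij_betw_cong b]) auto
    then have "bij_betw (w(e := t)) (I - {e} \<union> {e}) (J - {t} \<union> {t})"
      by (rule bij_betw_combine) (auto simp: bij_betw_def)
    then have bij: "bij_betw (w(e := t)) I J"
      using eI t by (simp add: insert_absorb)
    have "w x \<le> t" if "x \<in> I - {e}" for x
    proof -
      have "w x \<in> J" using b that by (auto dest: bij_betwE)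
      then show ?thesis using fin t by simp
    qed
    then have "\<not> t < w x" if "x \<in> I - {e}" for x
      using that by force
    moreover have "\<not> (i < e \<and> e < k)" if "i \<in> I" "k \<in> I" for i k
      using e Min_le[OF fin(1)] Max_ge[OF fin(1)] that by (metis leD)
    moreover have "peak_free (I - {e}) w"
      using w by (simp add: valleys_def)
    ultimately have "peak_free I (w(e := t))"
      unfolding peak_free_def by (metis DiffI fun_upd_apply singletonD)
    then show "w(e := t) \<in> valleys I J \<and> (w(e := t)) e = t"
      using w bij eI by (auto simp: valleys_def)
  qed
qed

text \<open>A maximum strictly inside would be a peak between the first and the last
  position.\<close>

lemma valleys_peak_at_end:
  assumes w: "w \<in> valleys I J" and fin: "finite I" "finite J" and ne: "J \<noteq> {}"
  shows "w (Min I) = Max J \<or> w (Max I) = Max J"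
proof -
  have b: "bij_betw w I J" and pf: "peak_free I w"
    using w by (auto simp: valleys_def)
  obtain x where x: "x \<in> I" "w x = Max J"
    using b Max_in[OF fin(2) ne] by (metis bij_betw_def imageE)
  have I: "Min I \<in> I" "Max I \<in> I" using x(1) fin(1) by (metis Min_in Max_in empty_iff)+
  have less: "w y < Max J" if "y \<in> I" "y \<noteq> x" for y
  proof -
    have "w y \<noteq> w x" "w y \<in> J" using b that x by (auto simp: bij_betw_def inj_on_def)
    then show ?thesis using fin x by (metis Max_ge le_neq_trans)
  qed
  have "x = Min I \<or> x = Max I"
  proof (rule ccontr)
    assume n: "\<not> (x = Min I \<or> x = Max I)"
    then have "Min I < x" "x < Max I"
      using x fin by (metis Min_le Max_ge le_neq_trans)+
    then show False
      using pf I x less[of "Min I"] less[of "Max I"] n unfolding peak_free_def by metis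
  qed
  then show ?thesis using x by auto
qed

text \<open>The largest value stands at one of the two ends, and deleting it leaves a peak-free word
  with one letter less. Each further letter therefore doubles the count.\<close>

lemma card_valleys:
  fixes I :: "'a::linorder set" and J :: "'b::{linorder, zero} set"
  assumes "finite I" "finite J" "card I = Suc n" "card J = Suc n"
  shows "card (valleys I J) = 2 ^ n"
  using assms
proof (induction n arbitrary: I J)
  case 0
  then obtain a b where [simp]: "I = {a}" "J = {b}" by (metis One_nat_def card_1_singletonE)
  have "valleys I J = {(\<lambda>x. 0)(a := b)}"
    by (auto simp: valleys_def peak_free_def bij_betw_def)
  then show ?case by simp
next
  case (Suc n)
  let ?V = "\<lambda>e. {w \<in> valleys I J. w e = Max J}"
  have I: "Min I \<in> I" "Max I \<in> I" "Max J \<in> J" "J \<noteq> {}"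
    using Suc.prems by (auto intro!: Min_in Max_in)
  have ne: "Min I \<noteq> Max I"
  proof
    assume eq: "Min I = Max I"
    have "I \<subseteq> {Max I}"
    proof
      fix x assume "x \<in> I"
      then have "Min I \<le> x" "x \<le> Max I" using Suc.prems by auto
      then show "x \<in> {Max I}" using eq by simp
    qed
    then have "card I \<le> 1" using card_mono[of "{Max I}" I] by simp
    then show False using Suc.prems by simp
  qed
  have card: "card (?V e) = 2 ^ n" if "e = Min I \<or> e = Max I" for e
  proof -
    have e: "e \<in> I" using that I by auto
    have "card (?V e) = card (valleys (I - {e}) (J - {Max J}))"
      by (rule bij_betw_same_card[OF bij_betw_valleys_remove]) (use Suc.prems that e I in auto)
    also have "\<dots> = 2 ^ n"
      using Suc.prems e I by (intro Suc.IH) auto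
    finally show ?thesis .
  qed
  have un: "valleys I J = ?V (Min I) \<union> ?V (Max I)"
    using valleys_peak_at_end[of _ I J] Suc.prems I by blast
  have disj: "?V (Min I) \<inter> ?V (Max I) = {}"
    using ne I by (auto simp: valleys_def bij_betw_def inj_on_def)
  \<comment> \<open>An infinite set would have cardinality 0, not \<open>2 ^ n\<close>.\<close>
  have fin: "finite (?V (Min I))" "finite (?V (Max I))"
    by (rule card_ge_0_finite, simp add: card)+
  have "card (valleys I J) = card (?V (Min I)) + card (?V (Max I))"
    by (subst un) (rule card_Un_disjoint[OF fin disj])
  then show ?case using card by simp
qed

subsection \<open>Avoiders that start with their maximum\<close>

text \<open>\<open>s\<close> is the length of the part in front of the block, \<open>k\<close> the
  number of cycles in the block.\<close>

definition max_first_avoiders :: "nat \<Rightarrow> nat \<Rightarrow> (nat \<Rightarrow> nat) set" where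
  "max_first_avoiders s k = {p \<in> three_cyclic_avoiders {s<..s + 3 * k}. p (Suc s) = s + 3 * k}"

text \<open>The middle element \<open>c\<close> of the cycle through both ends separates the
  excedances from their images. Since \<open>p\<close> decreases on positions up to \<open>c\<close>
  and among values from \<open>c\<close> on, these two sets are an initial and a final segment of
  length \<open>k\<close>, and the middle elements of the cycles fill the gap.\<close>

lemma max_first_avoiders_structure:
  assumes p: "p \<in> max_first_avoiders s k" and "0 < k"
  shows "x \<in> {s<..s + k} \<Longrightarrow> p x = s + 3 * k + 1 + s - x"
    and "bij_betw p {s + k<..s + 2 * k} {s<..s + k}"
proof -
  define m where "m = s + 3 * k"
  define I where "I = {s<..m}"
  have pI: "p \<in> three_cyclic_avoiders I" and first: "p (Suc s) = m"
    using p by (auto simp: max_first_avoiders_def I_def m_def)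
  note t = avoidersD(1)[OF pI] and a = avoidersD(2)[OF pI]
  note in_I = three_cyclic_in_iff[OF t] and p3 = three_cyclicD(3)[OF t]
    and p_eq = three_cyclic_eq_iff[OF t]
  \<comment> \<open>The cycle through both ends runs from \<open>Suc s\<close> to \<open>m\<close>
    to \<open>c\<close> and back, so the smallest value stands at position \<open>c\<close> and the
    value \<open>c\<close> at the last position.\<close>
  define c where "c = p m"
  have pc: "p c = Suc s" using p3[of "Suc s"] first by (simp add: c_def)
  have I: "Suc s \<in> I" "m \<in> I" "finite I" "card I = 3 * k"
    using \<open>0 < k\<close> by (auto simp: I_def m_def)
  have cI: "c \<in> I" using in_I I by (simp add: c_def)
  text \<open>Otherwise, the value \<open>Suc s\<close> at position \<open>c\<close> would complete a 231.\<close>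
  have dec_pos: "p j < p i" if "i \<in> I" "i < j" "j \<le> c" for i j
  proof -
    have ij: "j \<in> I" "p i \<in> I" "p i \<noteq> Suc s" "p i \<noteq> p j"
      using that cI p_eq[of i c] p_eq[of i j] in_I pc by (auto simp: I_def)
    show ?thesis
    proof (cases "j = c")
      case True
      then show ?thesis using ij pc by (auto simp: I_def)
    next
      case False
      then show ?thesis using avoids_231D[OF a, of i j c] ij that cI pc by (force simp: I_def)
    qed
  qed
  text \<open>Otherwise, the value \<open>c\<close> at position \<open>m\<close> would complete a 231.\<close>
  have dec_val: "p j < p i" if "i \<in> I" "j \<in> I" "i < j" "c \<le> p i" "c \<le> p j" for i j
  proof -
    have ij: "p i \<noteq> c" "p i \<noteq> p j"
      using that p_eq[of i m] p_eq[of i j] by (auto simp: I_def c_def)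
    show ?thesis
    proof (cases "j = m")
      case True
      then show ?thesis using ij that by (auto simp: c_def)
    next
      case False
      then show ?thesis using avoids_231D[OF a, of i j m] ij that I(2) by (force simp: I_def c_def)
    qed
  qed
  define M where "M = {x \<in> I. x < p x}"
  note part = excedance_partition[OF pI, folded M_def]
  have finM: "finite M" and cardM: "card M = k"
    using card_excedances[OF pI] I by (auto simp: M_def)
  have shape: "x \<in> I" "x < p (p x)" "p (p x) < p x" "p x \<in> I" "p (p x) \<in> I" if "x \<in> M" for x
    using that cycle_shape[OF pI, of x] in_I by (auto simp: M_def)
  \<comment> \<open>Positions \<open>p (p x) < p x\<close> carry the values
    \<open>x < p (p x)\<close>. This ascent contradicts \<open>dec_val\<close> if
    \<open>c \<le> x\<close>, and \<open>dec_pos\<close> in the next claim if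
    \<open>p x \<le> c\<close>.\<close>
  have M_less: "x < c" if x: "x \<in> M" for x
  proof (rule ccontr)
    assume "\<not> x < c"
    then have "c \<le> x" by simp
    then show False
      using dec_val[of "p (p x)" "p x"] shape[OF x] p3[of x] by auto
  qed
  have less_pM: "c < p x" if x: "x \<in> M" for x
  proof (rule ccontr)
    assume "\<not> c < p x"
    then show False
      using dec_pos[of "p (p x)" "p x"] shape[OF x] p3[of x] by auto
  qed
  have M_eq: "M = {s<..s + k}"
  proof -
    \<comment> \<open>Before \<open>c\<close>, moving left lowers the position and raises the value,
      so excedances propagate to the left.\<close>
    have "b \<in> M" if "x \<in> M" "s < b" "b < x" for b x
    proof -
      have "b \<in> I" using that shape(1)[of x] by (auto simp: I_def)
      moreover have "p x < p b"
        using dec_pos[of b x] M_less[of x] that \<open>b \<in> I\<close> by simp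
      ultimately show ?thesis using that by (auto simp: M_def)
    qed
    then show ?thesis
      using initial_segment_eq[OF finM, of s] cardM by (auto simp: M_def I_def)
  qed
  have card_pM: "card (p ` M) = k"
    using cardM p_eq by (metis (no_types, lifting) card_image inj_onI)
  have pM_eq: "p ` M = {s + 2 * k<..m}"
  proof -
    \<comment> \<open>The preimage \<open>y\<close> of \<open>b > z\<close> cannot lie to the right
      of \<open>x\<close>, since large values decrease; hence it lies in the initial segment
      \<open>M\<close>.\<close>
    have "b \<in> p ` M" if z: "z \<in> p ` M" "b \<le> m" "z < b" for b z
    proof -
      obtain x where x: "x \<in> M" "z = p x" using z by auto
      have bI: "b \<in> I" using z shape(4)[OF x(1)] x by (auto simp: I_def)
      define y where "y = p (p b)"
      have y: "p y = b" "y \<in> I" using p3 bI in_I by (auto simp: y_def)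
      have "\<not> x < y"
        using dec_val[of x y] less_pM[OF x(1)] shape(1)[OF x(1)] y x z by auto
      moreover have "s < y" "x \<in> {s<..s + k}" using y x M_eq by (auto simp: I_def)
      ultimately have "y \<in> M" unfolding M_eq by auto
      then show ?thesis using y by auto
    qed
    moreover have "0 \<notin> p ` M" "\<And>z. z \<in> p ` M \<Longrightarrow> z \<le> m"
      using shape(4) unfolding I_def by force+
    ultimately have "p ` M = {m - k<..m}"
      using final_segment_eq[of "p ` M" m] unfolding card_pM by blast
    then show ?thesis by (simp add: m_def add.commute)
  qed
  show "p x = s + 3 * k + 1 + s - x" if x: "x \<in> {s<..s + k}" for x
  proof -
    have "p x = s + 2 * k + s + k + 1 - x"
    proof (rule decreasing_interval_map[OF _ _ x])
      fix y assume "y \<in> {s<..s + k}"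
      then have "p y \<in> {s + 2 * k<..m}" using pM_eq M_eq by blast
      then show "p y \<in> {s + 2 * k<..s + 2 * k + k}" by (auto simp: m_def)
    next
      fix y z assume "y \<in> {s<..s + k}" "z \<in> {s<..s + k}" "y < z"
      then show "p z < p y"
        using dec_pos[of y z] M_less[of z] M_eq shape(1)[of y] by auto
    qed
    then show ?thesis by simp
  qed
  have ppM: "p ` p ` M = {s + k<..s + 2 * k}"
  proof -
    have "p ` p ` M = I - (M \<union> p ` M)" using part by blast
    also have "\<dots> = {s + k<..s + 2 * k}"
      unfolding pM_eq unfolding M_eq by (auto simp: I_def m_def)
    finally show ?thesis .
  qed
  have "p ` p ` p ` M = M" using p3 by (auto simp: image_image)
  then show "bij_betw p {s + k<..s + 2 * k} {s<..s + k}"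
    using p_eq by (auto simp: bij_betw_def inj_on_def ppM[symmetric] M_eq)
qed

text \<open>A peak among the middle positions is itself a 231 or turns into one among the last
  positions, where the permutation is the reversed inverse of its middle part.\<close>

lemma max_first_avoiders_peak_free:
  assumes p: "p \<in> max_first_avoiders s k" and "0 < k"
  shows "peak_free {s + k<..s + 2 * k} p"
  unfolding peak_free_def
proof (intro ballI impI notI)
  fix i j l assume ijl: "i \<in> {s + k<..s + 2 * k}" "j \<in> {s + k<..s + 2 * k}"
    "l \<in> {s + k<..s + 2 * k}" "i < j" "j < l" "p i < p j \<and> p l < p j"
  have pI: "p \<in> three_cyclic_avoiders {s<..s + 3 * k}"
    using p by (auto simp: max_first_avoiders_def)
  note t = avoidersD(1)[OF pI] and a = avoidersD(2)[OF pI]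
  define r where "r x = s + 3 * k + 1 + s - x" for x
  have mid: "p x \<in> {s<..s + k}" "p (r (p x)) = x" if "x \<in> {s + k<..s + 2 * k}" for x
  proof -
    show "p x \<in> {s<..s + k}"
      using max_first_avoiders_structure(2)[OF assms] that by (auto simp: bij_betw_def)
    then have "p (p x) = r (p x)"
      using max_first_avoiders_structure(1)[OF assms] by (simp add: r_def)
    then show "p (r (p x)) = x" using three_cyclicD(3)[OF t] by metis
  qed
  have "p i \<noteq> p l" using three_cyclic_eq_iff[OF t, of i l] ijl by simp
  then consider "p l < p i" | "p i < p l" by linarith
  then show False
  proof cases
    case 1
    then show False using avoids_231D[OF a, of i j l] ijl by auto
  next
    case 2
    \<comment> \<open>\<open>r\<close> reverses the order, and these three positions carry the
      values \<open>j\<close>, \<open>l\<close>, \<open>i\<close>, which form 231.\<close>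
    have "r (p j) < r (p l)" "r (p l) < r (p i)" "s < r (p j)" "r (p i) \<le> s + 3 * k"
      using ijl 2 mid(1)[of i] mid(1)[of j] mid(1)[of l] by (auto simp: r_def)
    then show False
      using avoids_231D[OF a, of "r (p j)" "r (p l)" "r (p i)"] ijl mid(2) by auto
  qed
qed

text \<open>The outer thirds are forced: the reversal \<open>r\<close> on the first, and on the last
  the inverse \<open>v\<close> of \<open>w\<close> after \<open>r\<close>, so that every cycle
  closes after three steps. Avoidance is checked by the third in which a 231 would begin.\<close>

lemma valley_extends:
  assumes w: "w \<in> valleys {s + k<..s + 2 * k} {s<..s + k}" and "0 < k"
  shows "\<exists>p \<in> max_first_avoiders s k. \<forall>x \<in> {s + k<..s + 2 * k}. p x = w x"
proof -
  define A B C I where "A = {s<..s + k}" "B = {s + k<..s + 2 * k}"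
    "C = {s + 2 * k<..s + 3 * k}" "I = {s<..s + 3 * k}"
  note defs = this
  define r where "r x = s + 3 * k + 1 + s - x" for x
  define v where "v = inv_into B w"
  define p where "p x = (if x \<in> A then r x else if x \<in> B then w x else if x \<in> C then v (r x) else x)" for x
  have b: "bij_betw w B A" and pf: "peak_free B w"
    using w by (auto simp: valleys_def defs)
  have w_in: "w x \<in> A" if "x \<in> B" for x using b that by (auto simp: bij_betw_def)
  have v_in: "v x \<in> B" "w (v x) = x" if "x \<in> A" for x
    using b that unfolding v_def by (auto simp: bij_betw_def inv_into_into f_inv_into_f)
  have v_w: "v (w x) = x" if "x \<in> B" for x
    using b that unfolding v_def by (auto simp: bij_betw_def)
  have r_in: "x \<in> A \<Longrightarrow> r x \<in> C" "x \<in> C \<Longrightarrow> r x \<in> A" "x \<in> I \<Longrightarrow> r (r x) = x" for x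
    by (auto simp: defs r_def)
  have I: "x \<in> I \<longleftrightarrow> x \<in> A \<or> x \<in> B \<or> x \<in> C" for x by (auto simp: defs)
  have disj: "x \<in> A \<Longrightarrow> x \<notin> B" "x \<in> A \<Longrightarrow> x \<notin> C" "x \<in> B \<Longrightarrow> x \<notin> C" for x
    by (auto simp: defs)
  have pA: "p x = r x" if "x \<in> A" for x using that by (simp add: p_def)
  have pB: "p x = w x" if "x \<in> B" for x using that disj by (auto simp: p_def)
  have pC: "p x = v (r x)" if "x \<in> C" for x using that disj by (auto simp: p_def)
  have out: "p x = x" if "x \<notin> I" for x using that I by (auto simp: p_def)
  have "p x \<noteq> x \<and> p (p (p x)) = x" if x: "x \<in> I" for x
  proof -
    consider "x \<in> A" | "x \<in> B" | "x \<in> C" using x I[of x] by auto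
    then show ?thesis
    proof cases
      case 1
      have "v x \<in> B" "p (r x) = v x" "p (v x) = x"
        using 1 r_in(1,3)[of x] v_in[of x] x by (simp_all add: pB pC)
      then show ?thesis using 1 disj r_in(1)[OF 1] by (simp add: pA) metis
    next
      case 2
      have "p (w x) = r (w x)" "p (r (w x)) = x"
        using w_in[OF 2] v_w[OF 2] r_in(1)[of "w x"] r_in(3)[of "w x"] I[of "w x"]
        by (simp_all add: pA pC)
      then show ?thesis using 2 disj w_in[OF 2] by (simp add: pB) metis
    next
      case 3
      have "p (v (r x)) = r x" "p (r x) = x" "v (r x) \<in> B"
        using r_in(2)[OF 3] r_in(3)[OF x] v_in[of "r x"] by (simp_all add: pA pB)
      then show ?thesis using 3 disj by (simp add: pC) metis
    qed
  qed
  then have "three_cyclic I p" using out unfolding three_cyclic_def by metis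
  moreover have "avoids_231 I p"
    unfolding avoids_231_def
  proof (intro ballI impI notI)
    fix i j l assume h: "i \<in> I" "j \<in> I" "l \<in> I" "i < j" "j < l" "p l < p i \<and> p i < p j"
    have less: "x < y" if "x \<in> A \<and> y \<in> B \<or> x \<in> A \<and> y \<in> C \<or> x \<in> B \<and> y \<in> C" for x y
      using that by (auto simp: defs)
    consider "i \<in> A" | "i \<in> B" | "i \<in> C" using h(1) I[of i] by auto
    then show False
    proof cases
      case 1
      \<comment> \<open>The first third holds the largest values in decreasing order, so nothing
        after \<open>i\<close> exceeds \<open>p i\<close>.\<close>
      have "p j < r i"
      proof -
        consider "j \<in> A" | "j \<in> B" | "j \<in> C" using h(2) I[of j] by auto
        then show ?thesis
        proof cases
          case 1
          then show ?thesis using \<open>i < j\<close> \<open>i \<in> A\<close> by (auto simp: pA r_def defs)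
        next
          case 2
          then show ?thesis using less[of "p j" "r i"] w_in r_in \<open>i \<in> A\<close> by (simp add: pB)
        next
          case 3
          then show ?thesis using less[of "p j" "r i"] v_in r_in \<open>i \<in> A\<close> by (simp add: pC)
        qed
      qed
      then show False using h 1 by (simp add: pA)
    next
      case 2
      \<comment> \<open>Positions in \<open>A\<close> lie to the left of \<open>i\<close>, and those
        in \<open>C\<close> carry values in \<open>B\<close>. Hence a 231 beginning in the middle
        third stays there and is a peak of \<open>w\<close>.\<close>
      have inB: "x \<in> B" if "x \<in> I" "i < x" "p x \<in> A" for x
      proof -
        have "x \<notin> A" using less[of x i] that 2 by auto
        moreover have "x \<notin> C" using pC[of x] v_in(1)[of "r x"] r_in(2)[of x] disj(1)[of "p x"] that(3) by metis
        ultimately show ?thesis using that(1) I[of x] by auto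
      qed
      have "p i \<in> A" using 2 w_in by (simp add: pB)
      moreover have "p l \<in> I"
        using three_cyclic_in_iff[OF \<open>three_cyclic I p\<close>] h by simp
      ultimately have "p l \<in> A" using h(6) less[of "p i" "p l"] I[of "p l"] by (metis less_asym)
      then have l: "l \<in> B" using inB h by auto
      then have "j \<in> B" using 2 h by (auto simp: defs)
      then show False using pf 2 l h unfolding peak_free_def by (metis less_trans pB)
    next
      case 3
      then have C: "i \<in> C" "j \<in> C" "l \<in> C" using h by (auto simp: defs)
      \<comment> \<open>At positions \<open>p l < p i < p j\<close> the word \<open>w\<close> has
        the values \<open>r l\<close>, \<open>r i\<close>, \<open>r j\<close>. As \<open>i\<close>
        is the smallest index, \<open>r i\<close> is the largest of them, hence a peak.\<close>
      have "w (p i) = r i" "w (p j) = r j" "w (p l) = r l" "p i \<in> B" "p j \<in> B" "p l \<in> B"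
        using C r_in v_in by (auto simp: pC)
      moreover have "r j < r i" "r l < r i" using C h by (auto simp: r_def defs)
      ultimately show False using pf h unfolding peak_free_def by metis
    qed
  qed
  moreover have "p (Suc s) = s + 3 * k"
  proof -
    have "Suc s \<in> A" using \<open>0 < k\<close> by (simp add: defs)
    then show ?thesis by (simp add: pA r_def)
  qed
  ultimately have "p \<in> max_first_avoiders s k"
    by (simp add: max_first_avoiders_def three_cyclic_avoiders_def defs)
  then show ?thesis using pB unfolding defs by blast
qed

text \<open>Restriction to the middle third, set to 0 elsewhere, is a bijection onto the peak-free
  words there, because the middle third determines the rest.\<close>

lemma card_max_first_avoiders: "card (max_first_avoiders s (Suc n)) = 2 ^ n"
proof -
  define k where "k = Suc n"
  then have "0 < k" by simp
  define B where "B = {s + k<..s + 2 * k}"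
  define f where "f p x = (if x \<in> B then p x else 0)" for p :: "nat \<Rightarrow> nat" and x
  have "bij_betw f (max_first_avoiders s k) (valleys B {s<..s + k})"
    unfolding bij_betw_def
  proof (intro conjI inj_onI equalityI subsetI)
    fix p q assume p: "p \<in> max_first_avoiders s k" and q: "q \<in> max_first_avoiders s k"
      and eq: "f p = f q"
    have tp: "three_cyclic {s<..s + 3 * k} p" and tq: "three_cyclic {s<..s + 3 * k} q"
      using p q by (auto simp: max_first_avoiders_def three_cyclic_avoiders_def)
    note sp = max_first_avoiders_structure[OF p \<open>0 < k\<close>]
      and sq = max_first_avoiders_structure[OF q \<open>0 < k\<close>]
    have low: "p x = q x" if "x \<in> {s<..s + k}" for x using sp(1) sq(1) that by simp
    have mid: "p x = q x" if "x \<in> B" for x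
      using fun_cong[OF eq, of x] that by (simp add: f_def)
    \<comment> \<open>Here \<open>x = p y\<close> and \<open>y = p b\<close> with \<open>b\<close>
      in the middle third, so both permutations must send \<open>x\<close> back to
      \<open>b\<close>.\<close>
    have high: "p x = q x" if x: "x \<in> {s + 2 * k<..s + 3 * k}" for x
    proof -
      define y where "y = s + 3 * k + 1 + s - x"
      have yA: "y \<in> {s<..s + k}" using x by (simp add: y_def; linarith)
      then have y: "y \<in> {s<..s + k}" "p y = x" "q y = x"
        using sp(1)[of y] sq(1)[of y] yA x by (auto simp: y_def)
      obtain b where b: "b \<in> B" "p b = y"
        using sp(2) y(1) unfolding B_def bij_betw_def by (metis imageE)
      then have "q b = y" using mid by simp
      then show ?thesis using b y three_cyclicD(3)[OF tp, of b] three_cyclicD(3)[OF tq, of b] by simp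
    qed
    show "p = q"
    proof
      fix x
      consider "x \<in> {s<..s + k}" | "x \<in> B" | "x \<in> {s + 2 * k<..s + 3 * k}" | "x \<notin> {s<..s + 3 * k}"
        by (force simp: B_def)
      then show "p x = q x"
        using low mid high three_cyclicD(2)[OF tp] three_cyclicD(2)[OF tq] by cases metis+
    qed
  next
    fix w assume "w \<in> f ` max_first_avoiders s k"
    then obtain p where p: "p \<in> max_first_avoiders s k" and w: "w = f p" by auto
    have "bij_betw w B {s<..s + k}"
      using max_first_avoiders_structure(2)[OF p \<open>0 < k\<close>]
      by (subst bij_betw_cong[where g = p]) (auto simp: w f_def B_def)
    moreover have "peak_free B w"
      using max_first_avoiders_peak_free[OF p \<open>0 < k\<close>]
      by (simp add: peak_free_def w f_def B_def)
    ultimately show "w \<in> valleys B {s<..s + k}"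
      by (simp add: valleys_def w f_def)
  next
    fix w assume w: "w \<in> valleys B {s<..s + k}"
    then obtain p where "p \<in> max_first_avoiders s k" "\<forall>x\<in>B. p x = w x"
      using valley_extends[of w s k] \<open>0 < k\<close> by (auto simp: B_def)
    moreover then have "w = f p" using w by (auto simp: f_def valleys_def)
    ultimately show "w \<in> f ` max_first_avoiders s k" by blast
  qed
  then have "card (max_first_avoiders s k) = card (valleys B {s<..s + k})"
    by (rule bij_betw_same_card)
  also have "\<dots> = 2 ^ n" by (rule card_valleys) (auto simp: B_def k_def)
  finally show ?thesis by (simp add: k_def)
qed

subsection \<open>Decomposition at the maximum\<close>

lemma avoiders_restrict:
  assumes p: "p \<in> three_cyclic_avoiders I" and "J \<subseteq> I" and inv: "p ` J = J"
  shows "restrict_id p J \<in> three_cyclic_avoiders J"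
proof -
  note t = avoidersD(1)[OF p] and a = avoidersD(2)[OF p]
  have [simp]: "p x \<in> J" if "x \<in> J" for x using inv that by blast
  have "three_cyclic J (restrict_id p J)"
    using three_cyclicD[OF t] \<open>J \<subseteq> I\<close> by (auto simp: three_cyclic_def restrict_id_def)
  moreover have "avoids_231 J (restrict_id p J)"
    unfolding avoids_231_def restrict_id_def
    using avoids_231D[OF a] \<open>J \<subseteq> I\<close> by simp (meson subsetD)
  ultimately show ?thesis by (simp add: three_cyclic_avoiders_def)
qed

text \<open>A 231 cannot straddle \<open>c\<close>: its last value is below its first, and
  \<open>p\<close> preserves \<open>{..c}\<close>, so a first position up to \<open>c\<close> forces
  the last position up to \<open>c\<close> as well.\<close>

lemma avoiders_append:
  fixes c d :: nat
  assumes q: "q \<in> three_cyclic_avoiders {0<..c}" and r: "r \<in> three_cyclic_avoiders {c<..d}"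
    and "c \<le> d"
  defines "p \<equiv> \<lambda>x. if x \<le> c then q x else r x"
  shows "p \<in> three_cyclic_avoiders {0<..d}"
proof -
  note tq = avoidersD(1)[OF q] and aq = avoidersD(2)[OF q]
    and tr = avoidersD(1)[OF r] and ar = avoidersD(2)[OF r]
  have q_le: "q x \<le> c \<longleftrightarrow> x \<le> c" for x
    using three_cyclic_in_iff[OF tq, of x] three_cyclicD(2)[OF tq, of x] by (cases "x \<in> {0<..c}") auto
  have r_le: "r x \<le> c \<longleftrightarrow> x \<le> c" for x
    using three_cyclic_in_iff[OF tr, of x] three_cyclicD(2)[OF tr, of x] by (cases "x \<in> {c<..d}") auto
  have "three_cyclic {0<..d} p"
    using three_cyclicD[OF tq] three_cyclicD[OF tr] q_le r_le \<open>c \<le> d\<close>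
    by (simp add: three_cyclic_def p_def)
  moreover have "avoids_231 {0<..d} p"
    unfolding avoids_231_def
  proof (intro ballI impI notI)
    fix i j k assume h: "i \<in> {0<..d}" "j \<in> {0<..d}" "k \<in> {0<..d}" "i < j" "j < k"
      "p k < p i \<and> p i < p j"
    have p_le: "p x \<le> c \<longleftrightarrow> x \<le> c" for x by (simp add: p_def q_le r_le)
    show False
    proof (cases "i \<le> c")
      case True
      then have "k \<le> c" using h p_le[of i] p_le[of k] by linarith
      then show False using avoids_231D[OF aq, of i j k] h by (simp add: p_def)
    next
      case False
      then show False using avoids_231D[OF ar, of i j k] h by (simp add: p_def)
    qed
  qed
  ultimately show ?thesis by (simp add: three_cyclic_avoiders_def)
qed

text \<open>Values before the maximum are below all values after it, so the positions before it are
  invariant. They carry an avoider of their own, and \<open>card_excedances\<close> makes their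
  number a multiple of 3.\<close>

lemma max_position:
  assumes p: "p \<in> three_cyclic_avoiders {0<..3 * n}" and "0 < n"
  shows "\<exists>j<n. p (Suc (3 * j)) = 3 * n"
    and "\<lbrakk>p (Suc c) = 3 * n; c \<le> 3 * n\<rbrakk> \<Longrightarrow> p ` {0<..c} = {0<..c}"
proof -
  define I where "I = {0<..3 * n}"
  note t = avoidersD(1)[OF p, folded I_def] and a = avoidersD(2)[OF p, folded I_def]
  note in_I = three_cyclic_in_iff[OF t] and p_eq = three_cyclic_eq_iff[OF t]
  have inj: "inj_on p A" for A using p_eq by (simp add: inj_on_def)
  have invariant: "p ` {0<..c} = {0<..c}" if c: "p (Suc c) = 3 * n" "c \<le> 3 * n" for c
  proof -
    have cI: "Suc c \<in> I" using in_I[of "Suc c"] c \<open>0 < n\<close> by (simp add: I_def)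
    have sub: "x \<in> I" if "x \<in> {0<..c}" for x using that c by (auto simp: I_def)
    \<comment> \<open>Otherwise \<open>b\<close> would stand behind the maximum, and
      \<open>y\<close>, \<open>3 * n\<close>, \<open>b\<close> would form 231.\<close>
    have down: "b \<in> p ` {0<..c}" if y: "y \<in> p ` {0<..c}" "0 < b" "b < y" for b y
    proof -
      obtain x where x: "x \<in> {0<..c}" "y = p x" using y by auto
      have px: "p x \<in> I" "p x \<noteq> p (Suc c)"
        using in_I[of x] sub[OF x(1)] p_eq[of x "Suc c"] x by auto
      then have less: "p x < p (Suc c)" using c by (auto simp: I_def)
      have bI: "b \<in> I" using px x y by (auto simp: I_def)
      define z where "z = p (p b)"
      have z: "p z = b" "z \<in> I" using three_cyclicD(3)[OF t] bI in_I by (auto simp: z_def)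
      have "\<not> Suc c < z"
        using avoids_231D[OF a, of x "Suc c" z] sub[OF x(1)] cI z less x y by auto
      moreover have "z \<noteq> Suc c" using z less x y by auto
      ultimately have "z \<in> {0<..c}" using z by (auto simp: I_def)
      then show ?thesis using z by blast
    qed
    have pos: "0 < y" if "y \<in> p ` {0<..c}" for y
      using that in_I sub unfolding I_def by fastforce
    have "p ` {0<..c} = {0<..0 + card (p ` {0<..c})}"
      by (rule initial_segment_eq) (simp, erule pos, erule down)
    then show ?thesis by (simp add: card_image[OF inj])
  qed
  then show "\<lbrakk>p (Suc c) = 3 * n; c \<le> 3 * n\<rbrakk> \<Longrightarrow> p ` {0<..c} = {0<..c}" .
  define m where "m = p (p (3 * n))"
  have m: "p m = 3 * n" "m \<in> I"
    using three_cyclicD(3)[OF t] in_I \<open>0 < n\<close> by (auto simp: m_def I_def)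
  \<comment> \<open>Positions start at 1, so this is the number of positions before the
    maximum.\<close>
  define c where "c = m - 1"
  have c: "m = Suc c" "c < 3 * n" using m by (auto simp: c_def I_def)
  have inv: "p ` {0<..c} = {0<..c}" using invariant m c by simp
  define q where "q = restrict_id p {0<..c}"
  have "q \<in> three_cyclic_avoiders {0<..c}"
    unfolding q_def by (rule avoiders_restrict[OF p _ inv]) (use c in auto)
  then have "c = 3 * card {x \<in> {0<..c}. x < q x}"
    using card_excedances[of q "{0<..c}"] by simp
  then show "\<exists>j<n. p (Suc (3 * j)) = 3 * n"
    using m(1) c by (metis mult_less_cancel1)
qed

text \<open>Cutting just before the maximum leaves an avoider with \<open>j\<close> cycles and a
  block of \<open>n - j\<close> cycles that starts with its maximum. Gluing two such pieces undoes
  the cut.\<close>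

lemma card_avoiders_max_at:
  assumes "j < n"
  shows "card {p \<in> three_cyclic_avoiders {0<..3 * n}. p (Suc (3 * j)) = 3 * n} =
         card (three_cyclic_avoiders {0<..3 * j}) * 2 ^ (n - 1 - j)"
proof -
  define c where "c = 3 * j"
  define k where "k = n - j"
  have k: "0 < k" "c + 3 * k = 3 * n" "k = Suc (n - 1 - j)"
    using assms by (auto simp: c_def k_def)
  let ?F = "{p \<in> three_cyclic_avoiders {0<..3 * n}. p (Suc c) = 3 * n}"
  have "bij_betw (\<lambda>p. (restrict_id p {0<..c}, restrict_id p {c<..3 * n})) ?F
     (three_cyclic_avoiders {0<..c} \<times> max_first_avoiders c k)"
  proof (rule bij_betw_byWitness[where f' = "\<lambda>(q, r) x. if x \<le> c then q x else r x"])
    show "\<forall>p\<in>?F. (\<lambda>(q, r) x. if x \<le> c then q x else r x)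
        (restrict_id p {0<..c}, restrict_id p {c<..3 * n}) = p"
      by (auto simp: fun_eq_iff restrict_id_def three_cyclic_avoiders_def three_cyclic_def)
    show "\<forall>qr\<in>three_cyclic_avoiders {0<..c} \<times> max_first_avoiders c k.
        (\<lambda>p. (restrict_id p {0<..c}, restrict_id p {c<..3 * n}))
          ((\<lambda>(q, r) x. if x \<le> c then q x else r x) qr) = qr"
    proof clarify
      fix q r
      assume "q \<in> three_cyclic_avoiders {0<..c}" "r \<in> max_first_avoiders c k"
      then have t: "three_cyclic {0<..c} q" "three_cyclic {c<..3 * n} r"
        by (simp_all add: max_first_avoiders_def three_cyclic_avoiders_def k(2))
      show "restrict_id (\<lambda>x. if x \<le> c then q x else r x) {0<..c} = q \<and>
          restrict_id (\<lambda>x. if x \<le> c then q x else r x) {c<..3 * n} = r"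
        using three_cyclicD(2)[OF t(1)] three_cyclicD(2)[OF t(2)]
        by (auto simp: restrict_id_def fun_eq_iff)
    qed
    show "(\<lambda>p. (restrict_id p {0<..c}, restrict_id p {c<..3 * n})) ` ?F
        \<subseteq> three_cyclic_avoiders {0<..c} \<times> max_first_avoiders c k"
    proof clarify
      fix p assume p: "p \<in> three_cyclic_avoiders {0<..3 * n}" "p (Suc c) = 3 * n"
      note t = avoidersD(1)[OF p(1)]
      have c: "c < 3 * n" using k by simp
      have low: "p ` {0<..c} = {0<..c}"
        using max_position(2)[OF p(1) _ p(2)] c by simp
      have "p ` {0<..3 * n} = {0<..3 * n}"
        using permutes_image[OF three_cyclic_permutes[OF t]] .
      moreover have "{c<..3 * n} = {0<..3 * n} - {0<..c}" using c by auto
      moreover have "inj p" using three_cyclic_eq_iff[OF t] by (simp add: inj_def)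
      ultimately have high: "p ` {c<..3 * n} = {c<..3 * n}"
        using low by (simp add: image_set_diff)
      have "restrict_id p {0<..c} \<in> three_cyclic_avoiders {0<..c}"
        by (rule avoiders_restrict[OF p(1) _ low]) (use c in auto)
      moreover have "restrict_id p {c<..3 * n} \<in> three_cyclic_avoiders {c<..3 * n}"
        by (rule avoiders_restrict[OF p(1) _ high]) auto
      ultimately show "restrict_id p {0<..c} \<in> three_cyclic_avoiders {0<..c} \<and>
          restrict_id p {c<..3 * n} \<in> max_first_avoiders c k"
        using c p(2) by (simp add: max_first_avoiders_def k(2))
    qed
    show "(\<lambda>(q, r) x. if x \<le> c then q x else r x) `
        (three_cyclic_avoiders {0<..c} \<times> max_first_avoiders c k) \<subseteq> ?F"
    proof clarify
      fix q r assume "q \<in> three_cyclic_avoiders {0<..c}" "r \<in> max_first_avoiders c k"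
      then show "(\<lambda>x. if x \<le> c then q x else r x) \<in> three_cyclic_avoiders {0<..3 * n} \<and>
          (if Suc c \<le> c then q (Suc c) else r (Suc c)) = 3 * n"
        using k by (auto simp: max_first_avoiders_def intro!: avoiders_append)
    qed
  qed
  then have "card ?F = card (three_cyclic_avoiders {0<..c} \<times> max_first_avoiders c k)"
    by (rule bij_betw_same_card)
  then show ?thesis
    by (simp add: card_cartesian_product k(3) card_max_first_avoiders c_def)
qed

lemma card_avoiders_recurrence:
  assumes "0 < n"
  shows "card (three_cyclic_avoiders {0<..3 * n}) =
         (\<Sum>j<n. card (three_cyclic_avoiders {0<..3 * j}) * 2 ^ (n - 1 - j))"
proof -
  define F where "F j = {p \<in> three_cyclic_avoiders {0<..3 * n}. p (Suc (3 * j)) = 3 * n}" for j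
  have "three_cyclic_avoiders {0<..3 * n} = (\<Union>j<n. F j)"
    using max_position(1) assms by (auto simp: F_def)
  moreover have "F i \<inter> F j = {}" if "i \<noteq> j" for i j
  proof (rule ccontr)
    assume "F i \<inter> F j \<noteq> {}"
    then obtain p where "p \<in> F i" "p \<in> F j" by blast
    then have "three_cyclic {0<..3 * n} p" "p (Suc (3 * i)) = p (Suc (3 * j))"
      by (simp_all add: F_def three_cyclic_avoiders_def)
    then show False using three_cyclic_eq_iff that by fastforce
  qed
  moreover have "finite (F j)" for j
    using finite_three_cyclic_avoiders[of "{0<..3 * n}"] by (simp add: F_def)
  ultimately have "card (three_cyclic_avoiders {0<..3 * n}) = (\<Sum>j<n. card (F j))"
    by (simp add: card_UN_disjoint)
  then show ?thesis by (simp add: F_def card_avoiders_max_at)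
qed

section \<open>Solution of the recurrence\<close>

text \<open>Passing from \<open>f (n + 1)\<close> to \<open>f (n + 2)\<close> doubles every old
  summand and adds the new summand \<open>f (n + 1)\<close>, which makes a factor 3.\<close>

lemma convolution_power_2_eq_power_3:
  fixes f :: "nat \<Rightarrow> nat"
  assumes "f 0 = 1" and rec: "\<And>n. 0 < n \<Longrightarrow> f n = (\<Sum>j<n. f j * 2 ^ (n - 1 - j))"
  shows "f (Suc n) = 3 ^ n"
proof (induction n)
  case 0
  then show ?case using rec[of 1] assms(1) by simp
next
  case (Suc n)
  have "(\<Sum>j<Suc n. f j * 2 ^ (Suc n - j)) = 2 * (\<Sum>j<Suc n. f j * 2 ^ (Suc n - 1 - j))"
    unfolding sum_distrib_left by (intro sum.cong) (auto simp: Suc_diff_le)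
  also have "\<dots> = 2 * f (Suc n)" using rec[of "Suc n"] by simp
  finally show ?case using rec[of "Suc (Suc n)"] Suc.IH by simp
qed

theorem theorem2p1:
  fixes n :: nat
  assumes "n \<ge> 1"
  shows "card (Av_star n [2, 3, 1]) = 3 ^ (n - 1)"
proof -
  \<comment> \<open>The empty permutation supplies the starting value 1 of the recurrence.\<close>
  have "three_cyclic_avoiders {0<..3 * (0::nat)} = {id}"
    by (auto simp: three_cyclic_avoiders_def three_cyclic_def avoids_231_def)
  then have "card (three_cyclic_avoiders {0<..3 * Suc (n - 1)}) = 3 ^ (n - 1)"
    using convolution_power_2_eq_power_3[of "\<lambda>n. card (three_cyclic_avoiders {0<..3 * n})" "n - 1"]
      card_avoiders_recurrence by simp
  then show ?thesis unfolding Av_star_231_eq using assms by simp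
qed

end
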